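(* Let $P_{XY}$ be a probability measure defined on $\mathcal{X}\times\mathcal{Y}$ with $|\mathcal{X}|=M<\infty$. Let $1\le L\le M$, consider a list decision rule $\mathcal{L}\colon\mathcal{Y}\to\binom{\mathcal{X}}{L}$, and denote its decoding error probability by $$P_{\mathcal{L}}=\mathbb{P}\bigl[X\notin\mathcal{L}(Y)\bigr].$$ Then, for all $\alpha\in(0,1)\cup(1,\infty)$, $$H_\alpha(X|Y)\le\log M-d_\alpha\bigl(P_{\mathcal{L}}\,\|\,1-\tfrac LM\bigr)=\frac{1}{1-\alpha}\log\Bigl(L^{1-\alpha}(1-P_{\mathcal{L}})^\alpha+(M-L)^{1-\alpha}P_{\mathcal{L}}^\alpha\Bigr),$$ with equality in the inequality if and only if, for ($P_Y$-almost) all $y\in\mathcal{Y}$, $$P_{X|Y}(x|y)=\begin{cases}\dfrac{P_{\mathcal{L}}}{M-L}, & x\notin\mathcal{L}(y),\\[2mm]\dfrac{1-P_{\mathcal{L}}}{L}, & x\in\mathcal{L}(y).\end{cases}$$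
   Context: Logarithms have an arbitrary fixed base larger than 1. $(X,Y)\sim P_{XY}$, with $\mathcal{Y}$ an arbitrary observation space. $\binom{\mathcal{X}}{L}$ denotes the set of all subsets of $\mathcal{X}$ of cardinality $L$. The Arimoto-R\'enyi conditional entropy of order $\alpha\in(0,1)\cup(1,\infty)$ is $$H_\alpha(X|Y)=\frac{\alpha}{1-\alpha}\log\mathbb{E}\left[\Bigl(\sum_{x\in\mathcal{X}}P_{X|Y}^\alpha(x|Y)\Bigr)^{1/\alpha}\right],$$ the expectation being over $Y\sim P_Y$. The binary R\'enyi divergence of order $\alpha\in(0,1)\cup(1,\infty)$ is (with extension by continuity to boundary values) $d_\alpha(p\|q)=\frac{1}{\alpha-1}\log\bigl(p^\alpha q^{1-\alpha}+(1-p)^\alpha(1-q)^{1-\alpha}\bigr)$. In the degenerate case $L=M$ one has $P_{\mathcal{L}}=0$, $d_\alpha(0\|0)=0$, and the term $(M-L)^{1-\alpha}P_{\mathcal{L}}^\alpha$ is read as $0$. *)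

theory Defs
  imports "HOL-Probability.Probability"
begin

text \<open>
  The joint law \<open>P\<close> lives on \<open>count_space X \<Otimes>\<^sub>M N\<close>, with \<open>X\<close> a finite alphabet and \<open>N\<close> an
  arbitrary measurable observation space.
\<close>

definition obs_law :: "'y measure \<Rightarrow> ('x \<times> 'y) measure \<Rightarrow> 'y measure" where
  "obs_law N P = distr P N snd"

text \<open>The sub-probability measure \<open>A \<mapsto> P ({x} \<times> A)\<close> on the observation space.\<close>

definition slice_law :: "'y measure \<Rightarrow> ('x \<times> 'y) measure \<Rightarrow> 'x \<Rightarrow> 'y measure" where
  "slice_law N P x = distr (density P (indicator ({x} \<times> space N))) N snd"

text \<open>
  The conditional probability of \<open>x\<close> given the observation \<open>y\<close>, as a Radon--Nikodym derivative.
  It is determined up to null sets of the law of the observation; the lemmas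
  \<open>nn_integral_cond_prob_given\<close> and \<open>cond_prob_given_unique\<close> below justify the choice.
\<close>

definition cond_prob_given :: "'y measure \<Rightarrow> ('x \<times> 'y) measure \<Rightarrow> 'x \<Rightarrow> 'y \<Rightarrow> real" where
  "cond_prob_given N P x y = enn2real (RN_deriv (obs_law N P) (slice_law N P x) y)"

definition arimoto_renyi_entropy ::
    "real \<Rightarrow> real \<Rightarrow> 'x set \<Rightarrow> 'y measure \<Rightarrow> ('x \<times> 'y) measure \<Rightarrow> real" where
  "arimoto_renyi_entropy b \<alpha> X N P =
     \<alpha> / (1 - \<alpha>) *
     log b (\<integral>y. (\<Sum>x\<in>X. cond_prob_given N P x y powr \<alpha>) powr (1 / \<alpha>) \<partial>obs_law N P)"

text \<open>
  The divergence of Bernoulli(p) from Bernoulli(q), for p and q in the closed unit interval.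
  The first branch lists the boundary points where the extension by continuity is infinite. At all
  others the formula with \<open>0 powr a = 0\<close> gives the right value; in particular
  \<open>d\<^sub>\<alpha>(0\<parallel>0) = d\<^sub>\<alpha>(1\<parallel>1) = 0\<close>.
\<close>

definition binary_renyi_div :: "real \<Rightarrow> real \<Rightarrow> real \<Rightarrow> real \<Rightarrow> ereal" where
  "binary_renyi_div b \<alpha> p q =
     (if \<alpha> < 1 \<and> (p = 0 \<and> q = 1 \<or> p = 1 \<and> q = 0) \<or>
         \<alpha> > 1 \<and> (p \<noteq> 0 \<and> q = 0 \<or> p \<noteq> 1 \<and> q = 1)
      then \<infinity>
      else ereal (1 / (\<alpha> - 1) *
             log b (p powr \<alpha> * q powr (1 - \<alpha>) + (1 - p) powr \<alpha> * (1 - q) powr (1 - \<alpha>))))"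

definition list_error_prob :: "('x \<times> 'y) measure \<Rightarrow> ('y \<Rightarrow> 'x set) \<Rightarrow> real" where
  "list_error_prob P \<L> = \<P>(z in P. fst z \<notin> \<L> (snd z))"

context
  fixes X :: "'x set" and N :: "'y measure" and P :: "('x \<times> 'y) measure" and x :: 'x
  assumes P: "prob_space P" "sets P = sets (count_space X \<Otimes>\<^sub>M N)" and x: "x \<in> X"
begin

lemma snd_measurable_joint: "snd \<in> measurable P N"
  using measurable_snd measurable_cong_sets[OF P(2) refl] by blast

lemma emeasure_slice_law:
  assumes A: "A \<in> sets N"
  shows "emeasure (slice_law N P x) A = emeasure P ({x} \<times> A)"
proof -
  have sp: "space P = X \<times> space N"
    using sets_eq_imp_space_eq[OF P(2)] by (simp add: space_pair_measure)
  have xN: "{x} \<times> space N \<in> sets P"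
    unfolding P(2) using x by (intro pair_measureI) auto
  have sA: "snd -` A \<inter> space P \<in> sets P"
    using snd_measurable_joint A by (rule measurable_sets)
  have "snd \<in> measurable (density P (indicator ({x} \<times> space N))) N"
    using snd_measurable_joint by simp
  then have "emeasure (slice_law N P x) A =
      emeasure (density P (indicator ({x} \<times> space N))) (snd -` A \<inter> space P)"
    unfolding slice_law_def using A by (simp add: emeasure_distr)
  also have "\<dots> = emeasure P (({x} \<times> space N) \<inter> (snd -` A \<inter> space P))"
    using xN sA by (rule emeasure_restricted)
  also have "({x} \<times> space N) \<inter> (snd -` A \<inter> space P) = {x} \<times> A"
    using x sets.sets_into_space[OF A] by (auto simp: sp)
  finally show ?thesis .
qed

lemma emeasure_obs_law:
  assumes A: "A \<in> sets N"
  shows "emeasure (obs_law N P) A = emeasure P (X \<times> A)"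
proof -
  have sp: "space P = X \<times> space N"
    using sets_eq_imp_space_eq[OF P(2)] by (simp add: space_pair_measure)
  have "snd -` A \<inter> space P = X \<times> A"
    using sets.sets_into_space[OF A] by (auto simp: sp)
  then show ?thesis
    unfolding obs_law_def using A snd_measurable_joint by (simp add: emeasure_distr)
qed

lemma prob_space_obs_law: "prob_space (obs_law N P)"
  unfolding obs_law_def using P(1) snd_measurable_joint by (rule prob_space.prob_space_distr)

lemma density_RN_deriv_slice_law:
  "density (obs_law N P) (RN_deriv (obs_law N P) (slice_law N P x)) = slice_law N P x"
proof -
  interpret Y: prob_space "obs_law N P" by (rule prob_space_obs_law)
  have le: "emeasure (slice_law N P x) A \<le> emeasure (obs_law N P) A" if A: "A \<in> sets N" for A
    unfolding emeasure_slice_law[OF A] emeasure_obs_law[OF A]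
    by (rule emeasure_mono) (use x A in \<open>auto simp: P(2)\<close>)
  have "absolutely_continuous (obs_law N P) (slice_law N P x)"
    unfolding absolutely_continuous_def
  proof
    fix A assume "A \<in> null_sets (obs_law N P)"
    then have "A \<in> sets N" "emeasure (obs_law N P) A = 0"
      by (auto simp: null_sets_def obs_law_def)
    with le[of A] show "A \<in> null_sets (slice_law N P x)"
      by (auto simp: null_sets_def slice_law_def)
  qed
  then show ?thesis
    by (rule Y.density_RN_deriv) (simp add: obs_law_def slice_law_def)
qed

lemma AE_cond_prob_given:
  "AE y in obs_law N P. RN_deriv (obs_law N P) (slice_law N P x) y = ennreal (cond_prob_given N P x y)"
proof -
  interpret Y: prob_space "obs_law N P" by (rule prob_space_obs_law)
  let ?f = "RN_deriv (obs_law N P) (slice_law N P x)"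
  have "(\<integral>\<^sup>+y. ?f y \<partial>obs_law N P) = emeasure (density (obs_law N P) ?f) (space (obs_law N P))"
    by (simp add: emeasure_density cong: nn_integral_cong)
  also have "\<dots> = emeasure P ({x} \<times> space N)"
    unfolding density_RN_deriv_slice_law
    using emeasure_slice_law[of "space N"] by (simp add: obs_law_def)
  also have "\<dots> < \<infinity>"
    using prob_space.emeasure_le_1[OF P(1)]
    by (metis ennreal_one_less_top infinity_ennreal_def le_less_trans)
  finally have "AE y in obs_law N P. ?f y \<noteq> \<infinity>"
    by (intro nn_integral_PInf_AE) auto
  then show ?thesis
    by eventually_elim (simp add: cond_prob_given_def less_top)
qed

lemma nn_integral_cond_prob_given:
  assumes A: "A \<in> sets N"
  shows "(\<integral>\<^sup>+y\<in>A. ennreal (cond_prob_given N P x y) \<partial>obs_law N P) = emeasure P ({x} \<times> A)"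
proof -
  let ?f = "RN_deriv (obs_law N P) (slice_law N P x)"
  have "(\<integral>\<^sup>+y\<in>A. ennreal (cond_prob_given N P x y) \<partial>obs_law N P) = (\<integral>\<^sup>+y\<in>A. ?f y \<partial>obs_law N P)"
    using AE_cond_prob_given by (intro nn_integral_cong_AE) auto
  also have "\<dots> = emeasure (density (obs_law N P) ?f) A"
    using A by (simp add: emeasure_density obs_law_def)
  finally show ?thesis
    unfolding density_RN_deriv_slice_law emeasure_slice_law[OF A] .
qed

lemma cond_prob_given_unique:
  assumes k: "k \<in> borel_measurable N" "\<And>y. y \<in> space N \<Longrightarrow> 0 \<le> k y"
    and eq: "\<And>A. A \<in> sets N \<Longrightarrow> (\<integral>\<^sup>+y\<in>A. ennreal (k y) \<partial>obs_law N P) = emeasure P ({x} \<times> A)"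
  shows "AE y in obs_law N P. cond_prob_given N P x y = k y"
proof -
  interpret Y: prob_space "obs_law N P" by (rule prob_space_obs_law)
  have k': "(\<lambda>y. ennreal (k y)) \<in> borel_measurable (obs_law N P)"
    using k(1) by (simp add: obs_law_def)
  have "density (obs_law N P) (\<lambda>y. ennreal (k y)) = slice_law N P x"
  proof (rule measure_eqI)
    show "sets (density (obs_law N P) (\<lambda>y. ennreal (k y))) = sets (slice_law N P x)"
      by (simp add: obs_law_def slice_law_def)
    fix A assume "A \<in> sets (density (obs_law N P) (\<lambda>y. ennreal (k y)))"
    then have A: "A \<in> sets N" by (simp add: obs_law_def)
    then have "A \<in> sets (obs_law N P)" by (simp add: obs_law_def)
    with k' show "emeasure (density (obs_law N P) (\<lambda>y. ennreal (k y))) A = emeasure (slice_law N P x) A"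
      by (simp add: emeasure_density eq[OF A] emeasure_slice_law[OF A])
  qed
  with k' have "AE y in obs_law N P. ennreal (k y) = RN_deriv (obs_law N P) (slice_law N P x) y"
    by (rule Y.RN_deriv_unique)
  moreover have "AE y in obs_law N P. y \<in> space N"
    using AE_space[of "obs_law N P"] by (simp add: obs_law_def)
  ultimately show ?thesis
    by eventually_elim (metis cond_prob_given_def enn2real_ennreal k(2))
qed

end

end

theory Submission
  imports Defs
begin

text \<open>
  For \<open>\<alpha> > 1\<close> the map \<open>v \<mapsto> \<parallel>v\<parallel>\<^sub>\<alpha>\<close> on posterior distributions lies above its tangent at the
  claimed extremal posterior \<open>w\<close>, with equality only at \<open>v = w\<close>; for \<open>\<alpha> < 1\<close> it lies below. Since \<open>w\<close>
  takes one value on the list and one off it, the tangent is an affine function of the posterior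
  probability of the list. Its expectation therefore depends only on the error probability, and it
  equals \<open>\<parallel>w\<parallel>\<^sub>\<alpha>\<close>. Taking expectations and then logarithms gives the bound and its equality case.
\<close>

section \<open>Scalar convexity, power means and the tangent of the \<alpha>-norm\<close>

text \<open>By the mean value theorem \<open>u powr a - 1\<close> is
  \<open>a * z powr (a - 1) * (u - 1)\<close> for some \<open>z\<close> strictly between
  \<open>u\<close> and 1. The slope is below \<open>a\<close> left of 1 and above \<open>a\<close>
  right of 1, so the gap is strictly positive on both sides. The point \<open>u = 0\<close> is
  separate because the derivative is taken at positive arguments.\<close>

lemma bernoulli_powr_strict:
  fixes a u :: real
  assumes "1 < a" "0 \<le> u" "u \<noteq> 1"
  shows "1 + a * (u - 1) < u powr a"
proof (cases "u = 0")
  case True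
  then show ?thesis using assms by simp
next
  case False
  then have u: "0 < u" using assms by simp
  have der: "((\<lambda>x. x powr a) has_real_derivative a * x powr (a - 1)) (at x)" if "0 < x" for x
    using that by (auto intro!: derivative_eq_intros)
  consider "u < 1" | "1 < u" using assms by linarith
  then show ?thesis
  proof cases
    case 1
    obtain z where z: "u < z" "z < 1" "1 powr a - u powr a = (1 - u) * (a * z powr (a - 1))"
      using MVT2[OF 1, of "\<lambda>x. x powr a" "\<lambda>x. a * x powr (a - 1)"] der u by force
    have "z powr (a - 1) < 1 powr (a - 1)"
      using z u assms by (intro powr_less_mono2) auto
    then have "(1 - u) * (a * z powr (a - 1)) < (1 - u) * (a * 1)"
      using 1 assms by simp
    with z show ?thesis by (simp add: algebra_simps)
  next
    case 2
    obtain z where z: "1 < z" "z < u" "u powr a - 1 powr a = (u - 1) * (a * z powr (a - 1))"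
      using MVT2[OF 2, of "\<lambda>x. x powr a" "\<lambda>x. a * x powr (a - 1)"] der by force
    have "1 powr (a - 1) < z powr (a - 1)"
      using z assms by (intro powr_less_mono2) auto
    then have "(u - 1) * (a * 1) < (u - 1) * (a * z powr (a - 1))"
      using 2 assms by simp
    with z show ?thesis by (simp add: algebra_simps)
  qed
qed

text \<open>Jensen's inequality for the power function, together with its equality case. It follows
  by averaging the strict Bernoulli inequality at the normalised values \<open>t x / m\<close>,
  where \<open>m\<close> is the weighted mean.\<close>

lemma powr_sum_le_sum_powr:
  fixes c t :: "'a \<Rightarrow> real"
  assumes A: "finite A" and c: "\<And>x. x \<in> A \<Longrightarrow> 0 < c x" "(\<Sum>x\<in>A. c x) = 1"
    and t: "\<And>x. x \<in> A \<Longrightarrow> 0 \<le> t x" and a: "1 < a"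
  shows "(\<Sum>x\<in>A. c x * t x) powr a \<le> (\<Sum>x\<in>A. c x * t x powr a)"
    and "(\<Sum>x\<in>A. c x * t x) powr a = (\<Sum>x\<in>A. c x * t x powr a) \<Longrightarrow>
      \<forall>x\<in>A. t x = (\<Sum>x\<in>A. c x * t x)"
proof -
  define m where "m = (\<Sum>x\<in>A. c x * t x)"
  have ct: "0 \<le> c x * t x" if "x \<in> A" for x
    using c(1)[OF that] t[OF that] by simp
  have "m powr a \<le> (\<Sum>x\<in>A. c x * t x powr a) \<and>
    (m powr a = (\<Sum>x\<in>A. c x * t x powr a) \<longrightarrow> (\<forall>x\<in>A. t x = m))"
  proof (cases "m = 0")
    case True
    then have "\<forall>x\<in>A. c x * t x = 0"
      using sum_nonneg_eq_0_iff[OF A ct] by (simp add: m_def)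
    then have "\<forall>x\<in>A. t x = 0" using c(1) by force
    with True a show ?thesis by simp
  next
    case False
    then have m: "0 < m" using sum_nonneg[of A "\<lambda>x. c x * t x"] ct by (simp add: m_def)
    \<comment> \<open>The weighted gap in Bernoulli's inequality at \<open>t x / m\<close>. Since
      these values have mean 1, the linear parts cancel in the sum, which leaves the Jensen gap
      divided by \<open>m powr a\<close>; each summand vanishes only where
      \<open>t x = m\<close>.\<close>
    define f where "f x = c x * ((t x / m) powr a - (1 + a * (t x / m - 1)))" for x
    have f0: "0 \<le> f x" and f1: "f x = 0 \<Longrightarrow> t x = m" if x: "x \<in> A" for x
    proof -
      have "0 \<le> t x / m" using t[OF x] m by simp
      from bernoulli_powr_strict[OF a this] show "0 \<le> f x" "f x = 0 \<Longrightarrow> t x = m"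
        using c(1)[OF x] m by (cases "t x / m = 1"; force simp: f_def)+
    qed
    have "(\<Sum>x\<in>A. f x) = (\<Sum>x\<in>A. c x * t x powr a / m powr a - ((1 - a) * c x + a / m * (c x * t x)))"
      using t m by (intro sum.cong) (auto simp: f_def powr_divide field_simps)
    also have "\<dots> = (\<Sum>x\<in>A. c x * t x powr a) / m powr a - ((1 - a) * (\<Sum>x\<in>A. c x) + a / m * m)"
      by (simp only: m_def sum_subtractf sum.distrib sum_distrib_left sum_divide_distrib)
    also have "\<dots> = (\<Sum>x\<in>A. c x * t x powr a) / m powr a - 1"
      using m c by simp
    finally have fs: "(\<Sum>x\<in>A. f x) = (\<Sum>x\<in>A. c x * t x powr a) / m powr a - 1" .
    have ma: "0 < m powr a" using m by simp
    have "0 \<le> (\<Sum>x\<in>A. f x)" using f0 by (rule sum_nonneg)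
    then have "m powr a \<le> (\<Sum>x\<in>A. c x * t x powr a)"
      unfolding fs using ma by (simp add: le_divide_eq)
    moreover have "\<forall>x\<in>A. t x = m" if "m powr a = (\<Sum>x\<in>A. c x * t x powr a)"
    proof -
      have "(\<Sum>x\<in>A. f x) = 0" unfolding fs that[symmetric] using ma by simp
      moreover have "(\<Sum>x\<in>A. f x) = 0 \<longleftrightarrow> (\<forall>x\<in>A. f x = 0)"
        using A f0 by (rule sum_nonneg_eq_0_iff)
      ultimately show ?thesis using f1 by blast
    qed
    ultimately show ?thesis by blast
  qed
  then show "(\<Sum>x\<in>A. c x * t x) powr a \<le> (\<Sum>x\<in>A. c x * t x powr a)"
    and "(\<Sum>x\<in>A. c x * t x) powr a = (\<Sum>x\<in>A. c x * t x powr a) \<Longrightarrow>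
      \<forall>x\<in>A. t x = (\<Sum>x\<in>A. c x * t x)"
    unfolding m_def by blast+
qed

text \<open>The factor \<open>1 - a\<close> reverses the inequality for \<open>a > 1\<close>, so that one statement covers both ranges.\<close>

lemma power_mean_compare:
  fixes c t :: "'a \<Rightarrow> real"
  assumes A: "finite A" and c: "\<And>x. x \<in> A \<Longrightarrow> 0 < c x" "(\<Sum>x\<in>A. c x) = 1"
    and t: "\<And>x. x \<in> A \<Longrightarrow> 0 \<le> t x" and a: "0 < a" "a \<noteq> 1"
  shows "(1 - a) * (\<Sum>x\<in>A. c x * t x powr a) powr (1 / a) \<le> (1 - a) * (\<Sum>x\<in>A. c x * t x)"
    and "(\<Sum>x\<in>A. c x * t x powr a) powr (1 / a) = (\<Sum>x\<in>A. c x * t x) \<Longrightarrow> \<exists>k. \<forall>x\<in>A. t x = k"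
proof -
  have s0: "0 \<le> (\<Sum>x\<in>A. c x * t x)"
    using c(1) t by (intro sum_nonneg mult_nonneg_nonneg) (auto intro: less_imp_le)
  have sa0: "0 \<le> (\<Sum>x\<in>A. c x * t x powr a)"
    using c(1) by (intro sum_nonneg mult_nonneg_nonneg) (auto intro: less_imp_le)
  have "(1 - a) * (\<Sum>x\<in>A. c x * t x powr a) powr (1 / a) \<le> (1 - a) * (\<Sum>x\<in>A. c x * t x) \<and>
   ((\<Sum>x\<in>A. c x * t x powr a) powr (1 / a) = (\<Sum>x\<in>A. c x * t x) \<longrightarrow> (\<exists>k. \<forall>x\<in>A. t x = k))"
  proof (cases "1 < a")
    case True
    note pm = powr_sum_le_sum_powr[of A c t a, OF A c t True]
    have "((\<Sum>x\<in>A. c x * t x) powr a) powr (1 / a) \<le> (\<Sum>x\<in>A. c x * t x powr a) powr (1 / a)"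
      using pm(1) a by (intro powr_mono2) auto
    moreover have "((\<Sum>x\<in>A. c x * t x) powr a) powr (1 / a) = (\<Sum>x\<in>A. c x * t x)"
      using s0 a by (simp add: powr_powr)
    ultimately have "(\<Sum>x\<in>A. c x * t x) \<le> (\<Sum>x\<in>A. c x * t x powr a) powr (1 / a)" by simp
    moreover have "\<exists>k. \<forall>x\<in>A. t x = k"
      if "(\<Sum>x\<in>A. c x * t x powr a) powr (1 / a) = (\<Sum>x\<in>A. c x * t x)"
    proof -
      have "(\<Sum>x\<in>A. c x * t x) powr a = (\<Sum>x\<in>A. c x * t x powr a)"
        unfolding that[symmetric] using sa0 a by (simp add: powr_powr)
      with pm(2) show ?thesis by blast
    qed
    ultimately show ?thesis using True by (auto intro: mult_left_mono_neg)
  next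
    case False
    then have a1: "a < 1" using a by simp
    have t': "(t x powr a) powr (1 / a) = t x" if "x \<in> A" for x
      using t[OF that] a by (simp add: powr_powr)
    have s: "(\<Sum>x\<in>A. c x * (t x powr a) powr (1 / a)) = (\<Sum>x\<in>A. c x * t x)"
      using t' by (intro sum.cong) auto
    \<comment> \<open>For \<open>a < 1\<close> the exponent \<open>1 / a\<close> exceeds 1, so
      Jensen applies to the values \<open>t x powr a\<close> and gives the reversed comparison of
      means.\<close>
    note pm = powr_sum_le_sum_powr[of A c "\<lambda>x. t x powr a" "1 / a", OF A c, unfolded s]
    have "\<exists>k. \<forall>x\<in>A. t x = k"
      if "(\<Sum>x\<in>A. c x * t x powr a) powr (1 / a) = (\<Sum>x\<in>A. c x * t x)"
    proof -
      have "\<forall>x\<in>A. t x powr a = (\<Sum>x\<in>A. c x * t x powr a)"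
        using that a a1 by (intro pm(2)) auto
      then show ?thesis using t' by metis
    qed
    with pm(1) a a1 show ?thesis by (auto intro: mult_left_mono)
  qed
  then show "(1 - a) * (\<Sum>x\<in>A. c x * t x powr a) powr (1 / a) \<le> (1 - a) * (\<Sum>x\<in>A. c x * t x)"
    and "(\<Sum>x\<in>A. c x * t x powr a) powr (1 / a) = (\<Sum>x\<in>A. c x * t x) \<Longrightarrow> \<exists>k. \<forall>x\<in>A. t x = k"
    by auto
qed

text \<open>
  The right-hand side is the tangent at \<open>w\<close> of the \<open>a\<close>-norm. After division by \<open>W powr (1 / a)\<close>
  the inequality compares power means of the ratios \<open>v / w\<close> under the weights \<open>w powr a / W\<close>.
\<close>

lemma powr_norm_tangent:
  fixes v w :: "'a \<Rightarrow> real"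
  assumes A: "finite A" and v: "\<And>x. x \<in> A \<Longrightarrow> 0 \<le> v x" "(\<Sum>x\<in>A. v x) = 1"
    and w: "\<And>x. x \<in> A \<Longrightarrow> 0 \<le> w x" "(\<Sum>x\<in>A. w x) = 1"
    and ac: "\<forall>x\<in>A. w x = 0 \<longrightarrow> v x = 0"
    and a: "0 < a" "a \<noteq> 1"
  defines "W \<equiv> \<Sum>x\<in>A. w x powr a"
  shows "(1 - a) * (\<Sum>x\<in>A. v x powr a) powr (1 / a)
      \<le> (1 - a) * (W powr (1 / a - 1) * (\<Sum>x\<in>A. w x powr (a - 1) * v x))"
    and "(\<Sum>x\<in>A. v x powr a) powr (1 / a)
        = W powr (1 / a - 1) * (\<Sum>x\<in>A. w x powr (a - 1) * v x) \<longleftrightarrow> (\<forall>x\<in>A. v x = w x)"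
proof -
  \<comment> \<open>The support of \<open>w\<close>, on which the ratios \<open>v / w\<close> make
    sense. Nothing is lost off it: \<open>ac\<close> removes the terms \<open>v x powr a\<close>,
    and \<open>0 powr (a - 1) = 0\<close> removes those of the linear form.\<close>
  define B where "B = {x \<in> A. w x \<noteq> 0}"
  have B: "finite B" "B \<subseteq> A" using A by (auto simp: B_def)
  have wB: "0 < w x" if "x \<in> B" for x using that w(1)[of x] by (auto simp: B_def)
  have "B \<noteq> {}"
  proof
    assume "B = {}"
    then have "(\<Sum>x\<in>A. w x) = 0" by (auto simp: B_def)
    with w(2) show False by simp
  qed
  have WB: "W = (\<Sum>x\<in>B. w x powr a)"
    unfolding W_def by (rule sum.mono_neutral_right) (use A in \<open>auto simp: B_def\<close>)
  have W: "0 < W" unfolding WB using B(1) \<open>B \<noteq> {}\<close> by (rule sum_pos) (use wB in force)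
  let ?c = "\<lambda>x. w x powr a / W" and ?t = "\<lambda>x. v x / w x"
  have c: "0 < ?c x" if "x \<in> B" for x using wB[OF that] W by simp
  have c1: "(\<Sum>x\<in>B. ?c x) = 1" using W by (simp add: WB flip: sum_divide_distrib)
  have t: "0 \<le> ?t x" if "x \<in> B" for x using that w(1) v(1) B(2) by auto
  have s1: "(\<Sum>x\<in>B. ?c x * ?t x) = (\<Sum>x\<in>A. w x powr (a - 1) * v x) / W"
  proof -
    have "(\<Sum>x\<in>A. w x powr (a - 1) * v x) = (\<Sum>x\<in>B. w x powr (a - 1) * v x)"
      by (rule sum.mono_neutral_right) (use A in \<open>auto simp: B_def\<close>)
    moreover have "(\<Sum>x\<in>B. ?c x * ?t x) = (\<Sum>x\<in>B. w x powr (a - 1) * v x / W)"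
      using wB by (intro sum.cong) (auto simp: powr_diff less_imp_le abs_of_pos)
    ultimately show ?thesis by (simp add: sum_divide_distrib)
  qed
  have s2: "(\<Sum>x\<in>B. ?c x * ?t x powr a) = (\<Sum>x\<in>A. v x powr a) / W"
  proof -
    have "(\<Sum>x\<in>A. v x powr a) = (\<Sum>x\<in>B. v x powr a)"
      by (rule sum.mono_neutral_right) (use A ac in \<open>auto simp: B_def\<close>)
    moreover have "(\<Sum>x\<in>B. ?c x * ?t x powr a) = (\<Sum>x\<in>B. v x powr a / W)"
    proof (intro sum.cong refl)
      fix x assume "x \<in> B"
      with wB[OF this] v(1)[of x] B(2) show "?c x * ?t x powr a = v x powr a / W"
        by (auto simp: powr_divide)
    qed
    ultimately show ?thesis by (simp add: sum_divide_distrib)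
  qed
  let ?V = "\<Sum>x\<in>A. v x powr a" and ?S = "\<Sum>x\<in>A. w x powr (a - 1) * v x"
  have V0: "0 \<le> ?V" by (intro sum_nonneg) auto
  have sc1: "?V powr (1 / a) = W powr (1 / a) * (?V / W) powr (1 / a)"
    using V0 W by (simp add: powr_divide)
  have sc2: "W powr (1 / a - 1) * ?S = W powr (1 / a) * (?S / W)"
    using W by (simp add: powr_diff)
  note pm = power_mean_compare[of B ?c ?t a, OF B(1) c c1 t a, unfolded s1 s2]
  have "W powr (1 / a) * ((1 - a) * (?V / W) powr (1 / a)) \<le> W powr (1 / a) * ((1 - a) * (?S / W))"
    by (rule mult_left_mono, use pm(1) in blast, rule powr_ge_zero)
  then show "(1 - a) * ?V powr (1 / a) \<le> (1 - a) * (W powr (1 / a - 1) * ?S)"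
    unfolding sc1 sc2 by (simp only: ac_simps)
  show "?V powr (1 / a) = W powr (1 / a - 1) * ?S \<longleftrightarrow> (\<forall>x\<in>A. v x = w x)"
  proof
    assume "?V powr (1 / a) = W powr (1 / a - 1) * ?S"
    moreover have "W powr (1 / a) \<noteq> 0" using W by simp
    ultimately have "(?V / W) powr (1 / a) = ?S / W"
      unfolding sc1 sc2 using mult_left_cancel by blast
    then obtain k where "\<forall>x\<in>B. ?t x = k" using pm(2) by blast
    then have vk: "v x = k * w x" if "x \<in> A" for x
      using that ac by (cases "w x = 0") (auto simp: B_def field_simps)
    \<comment> \<open>Both vectors have total mass 1, which forces the proportionality factor
      \<open>k\<close> to be 1.\<close>
    then have "(\<Sum>x\<in>A. v x) = k * (\<Sum>x\<in>A. w x)" by (simp add: sum_distrib_left)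
    with v w vk show "\<forall>x\<in>A. v x = w x" by simp
  next
    assume eq: "\<forall>x\<in>A. v x = w x"
    have "?S = W"
      unfolding W_def
    proof (intro sum.cong refl)
      fix x assume "x \<in> A"
      with w(1)[OF this] eq show "w x powr (a - 1) * v x = w x powr a"
        by (cases "w x = 0") (auto simp: powr_diff)
    qed
    moreover have "?V = W" unfolding W_def using eq by (intro sum.cong) auto
    ultimately show "?V powr (1 / a) = W powr (1 / a - 1) * ?S"
      using W by (simp add: powr_diff)
  qed
qed

section \<open>The posterior as a probability vector, and the mean posterior mass of the
  list\<close>

lemma sets_obs_law: "sets (obs_law N P) = sets N"
  by (simp add: obs_law_def)

lemma space_obs_law: "space (obs_law N P) = space N"
  by (simp add: obs_law_def)

lemma measurable_cond_prob_given: "cond_prob_given N P x \<in> borel_measurable (obs_law N P)"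
  unfolding cond_prob_given_def[abs_def] by measurable

lemma cond_prob_given_nonneg: "0 \<le> cond_prob_given N P x y"
  by (simp add: cond_prob_given_def)

context
  fixes X :: "'x set" and N :: "'y measure" and P :: "('x \<times> 'y) measure"
  assumes P: "prob_space P" "sets P = sets (count_space X \<Otimes>\<^sub>M N)" and X: "finite X"
begin

text \<open>The sum and the constant 1 have the same integral over every \<open>A\<close>, because
  the slices \<open>{x} \<times> A\<close> partition \<open>X \<times> A\<close>. Densities with
  respect to the law of the observation are unique almost everywhere.\<close>

lemma AE_sum_cond_prob_given: "AE y in obs_law N P. (\<Sum>x\<in>X. cond_prob_given N P x y) = 1"
proof (cases "X = {}")
  case True
  then have "space P = {}"
    using sets_eq_imp_space_eq[OF P(2)] by (simp add: space_pair_measure)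
  with prob_space.not_empty[OF P(1)] show ?thesis by simp
next
  case False
  then obtain x0 where x0: "x0 \<in> X" by blast
  interpret Y: prob_space "obs_law N P" by (rule prob_space_obs_law[OF P x0])
  let ?f = "\<lambda>y. \<Sum>x\<in>X. ennreal (cond_prob_given N P x y)"
  note [measurable] = measurable_cond_prob_given
  have fm: "?f \<in> borel_measurable (obs_law N P)" by measurable
  have "density (obs_law N P) ?f = density (obs_law N P) (\<lambda>_. 1)"
  proof (rule measure_eqI)
    fix A assume "A \<in> sets (density (obs_law N P) ?f)"
    then have A: "A \<in> sets N" by (simp add: sets_obs_law)
    then have A'[measurable]: "A \<in> sets (obs_law N P)" by (simp add: sets_obs_law)
    have "emeasure (density (obs_law N P) ?f) A
        = (\<integral>\<^sup>+y. (\<Sum>x\<in>X. ennreal (cond_prob_given N P x y) * indicator A y) \<partial>obs_law N P)"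
      by (simp add: emeasure_density[OF fm A'] sum_distrib_right)
    also have "\<dots> = (\<Sum>x\<in>X. \<integral>\<^sup>+y\<in>A. ennreal (cond_prob_given N P x y) \<partial>obs_law N P)"
      by (intro nn_integral_sum) measurable
    also have "\<dots> = (\<Sum>x\<in>X. emeasure P ({x} \<times> A))"
      by (intro sum.cong refl nn_integral_cond_prob_given[OF P _ A])
    also have "\<dots> = emeasure P (\<Union>x\<in>X. {x} \<times> A)"
      by (rule sum_emeasure) (use X A P(2) in \<open>auto simp: disjoint_family_on_def intro!: pair_measureI\<close>)
    also have "(\<Union>x\<in>X. {x} \<times> A) = X \<times> A" by auto
    also have "emeasure P (X \<times> A) = emeasure (obs_law N P) A"
      using emeasure_obs_law[OF P x0 A] by simp
    finally show "emeasure (density (obs_law N P) ?f) A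
        = emeasure (density (obs_law N P) (\<lambda>_. 1)) A"
      using A' by (simp add: emeasure_density)
  qed simp
  then have "AE y in obs_law N P. ?f y = 1"
    using Y.density_unique_iff[OF fm, of "\<lambda>_. 1"] by simp
  then show ?thesis
  proof eventually_elim
    case (elim y)
    then have "ennreal (\<Sum>x\<in>X. cond_prob_given N P x y) = ennreal 1"
      using cond_prob_given_nonneg by (subst (asm) sum_ennreal) auto
    then show ?case
      by (subst (asm) ennreal_inj) (auto intro: sum_nonneg cond_prob_given_nonneg)
  qed
qed

lemma AE_cond_prob_given_le_1: "AE y in obs_law N P. \<forall>x\<in>X. cond_prob_given N P x y \<le> 1"
  using AE_sum_cond_prob_given
proof eventually_elim
  case (elim y)
  show ?case
  proof
    fix x assume "x \<in> X"
    then have "cond_prob_given N P x y \<le> (\<Sum>x\<in>X. cond_prob_given N P x y)"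
      using X by (intro member_le_sum cond_prob_given_nonneg)
    with elim show "cond_prob_given N P x y \<le> 1" by simp
  qed
qed

lemma integral_cond_prob_given:
  assumes x: "x \<in> X" and A: "A \<in> sets N"
  shows "integrable (obs_law N P) (\<lambda>y. indicator A y * cond_prob_given N P x y)"
    and "(\<integral>y. indicator A y * cond_prob_given N P x y \<partial>obs_law N P) = measure P ({x} \<times> A)"
proof -
  interpret prob_space P by (rule P)
  note [measurable] = measurable_cond_prob_given
  have A'[measurable]: "A \<in> sets (obs_law N P)" using A by (simp add: sets_obs_law)
  have "(\<integral>\<^sup>+y. ennreal (indicator A y * cond_prob_given N P x y) \<partial>obs_law N P)
      = (\<integral>\<^sup>+y\<in>A. ennreal (cond_prob_given N P x y) \<partial>obs_law N P)"
    by (intro nn_integral_cong) (simp add: indicator_def)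
  also have "\<dots> = ennreal (measure P ({x} \<times> A))"
    by (simp add: nn_integral_cond_prob_given[OF P x A] emeasure_eq_measure)
  finally have nn: "(\<integral>\<^sup>+y. ennreal (indicator A y * cond_prob_given N P x y) \<partial>obs_law N P)
      = ennreal (measure P ({x} \<times> A))" .
  have m: "(\<lambda>y. indicator A y * cond_prob_given N P x y) \<in> borel_measurable (obs_law N P)"
    by measurable
  show "integrable (obs_law N P) (\<lambda>y. indicator A y * cond_prob_given N P x y)"
    using m by (rule integrableI_nn_integral_finite[OF _ _ nn]) (simp_all add: cond_prob_given_nonneg)
  show "(\<integral>y. indicator A y * cond_prob_given N P x y \<partial>obs_law N P) = measure P ({x} \<times> A)"
    using m by (subst integral_eq_nn_integral) (simp_all add: nn cond_prob_given_nonneg)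
qed

text \<open>The event of correct decoding is the finite disjoint union of the rectangles
  \<open>{x} \<times> A x\<close>, where \<open>A x\<close> collects the observations whose list
  contains \<open>x\<close>. Each rectangle has the integral of the posterior of \<open>x\<close>
  over \<open>A x\<close> as its probability.\<close>

lemma integral_list_posterior:
  assumes \<L>: "\<L> \<in> measurable N (count_space {S. S \<subseteq> X \<and> card S = L})"
  defines "V \<equiv> \<lambda>y. \<Sum>x\<in>X. if x \<in> \<L> y then cond_prob_given N P x y else 0"
  shows "integrable (obs_law N P) V"
    and "(\<integral>y. V y \<partial>obs_law N P) = 1 - list_error_prob P \<L>"
    and "list_error_prob P \<L> \<in> {0..1}"
proof -
  interpret prob_space P by (rule P)
  define A where "A x = {y \<in> space N. x \<in> \<L> y}" for x
  have sp: "space P = X \<times> space N"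
    using sets_eq_imp_space_eq[OF P(2)] by (simp add: space_pair_measure)
  have A: "A x \<in> sets N" for x
  proof -
    have "A x = \<L> -` {S. S \<subseteq> X \<and> card S = L \<and> x \<in> S} \<inter> space N"
      using measurable_space[OF \<L>] by (auto simp: A_def)
    also have "\<dots> \<in> sets N" by (rule measurable_sets[OF \<L>]) auto
    finally show ?thesis .
  qed
  have V: "V y = (\<Sum>x\<in>X. indicator (A x) y * cond_prob_given N P x y)"
    if "y \<in> space (obs_law N P)" for y
    using that unfolding V_def by (intro sum.cong) (auto simp: A_def space_obs_law)
  have i: "integrable (obs_law N P) (\<lambda>y. \<Sum>x\<in>X. indicator (A x) y * cond_prob_given N P x y)"
    by (intro Bochner_Integration.integrable_sum integral_cond_prob_given(1) A)
  then show "integrable (obs_law N P) V"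
    using V by (subst Bochner_Integration.integrable_cong[OF refl V])
  have S: "{x} \<times> A x \<in> sets P" if "x \<in> X" for x
    unfolding P(2) using that A by (intro pair_measureI) auto
  have U: "(\<Union>x\<in>X. {x} \<times> A x) \<in> sets P" using X S by (intro sets.finite_UN) auto
  have "(\<integral>y. V y \<partial>obs_law N P)
      = (\<integral>y. (\<Sum>x\<in>X. indicator (A x) y * cond_prob_given N P x y) \<partial>obs_law N P)"
    by (rule Bochner_Integration.integral_cong[OF refl V])
  also have "\<dots> = (\<Sum>x\<in>X. measure P ({x} \<times> A x))"
    using integral_cond_prob_given[OF _ A] by (subst Bochner_Integration.integral_sum) auto
  also have "\<dots> = prob (\<Union>x\<in>X. {x} \<times> A x)"
    by (rule finite_measure_finite_Union[symmetric])
      (use X S in \<open>auto simp: disjoint_family_on_def\<close>)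
  also have "\<dots> = 1 - prob (space P - (\<Union>x\<in>X. {x} \<times> A x))"
    using prob_compl[OF U] by simp
  also have "space P - (\<Union>x\<in>X. {x} \<times> A x) = {z \<in> space P. fst z \<notin> \<L> (snd z)}"
    by (auto simp: sp A_def)
  finally show "(\<integral>y. V y \<partial>obs_law N P) = 1 - list_error_prob P \<L>"
    by (simp add: list_error_prob_def)
  show "list_error_prob P \<L> \<in> {0..1}" by (simp add: list_error_prob_def)
qed

end

section \<open>The extremal posterior and its power sums\<close>

text \<open>The tangent point \<open>w\<close>, with \<open>e\<close> in the role of the error
  probability. When \<open>S\<close> is a list of size \<open>L = M\<close>, it is all of
  \<open>X\<close>, and no letter reaches the branch that divides by zero.\<close>

definition list_posterior :: "nat \<Rightarrow> nat \<Rightarrow> real \<Rightarrow> 'x set \<Rightarrow> 'x \<Rightarrow> real" where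
  "list_posterior M L e S x = (if x \<in> S then (1 - e) / real L else e / (real M - real L))"

text \<open>The argument of the logarithm in the closed form of the bound. For \<open>L = M\<close>
  the convention \<open>0 powr a = 0\<close> makes the second term 0.\<close>

definition list_powr_sum :: "nat \<Rightarrow> nat \<Rightarrow> real \<Rightarrow> real \<Rightarrow> real" where
  "list_powr_sum M L \<alpha> e =
     real L powr (1 - \<alpha>) * (1 - e) powr \<alpha> + (real M - real L) powr (1 - \<alpha>) * e powr \<alpha>"

text \<open>The contribution to a power sum of \<open>l\<close> points that share the mass
  \<open>s\<close> equally. An empty block, \<open>l = 0\<close>, gives 0 on both sides.\<close>

lemma mult_divide_powr:
  fixes l s \<alpha> :: real
  assumes "0 \<le> l" "0 \<le> s"
  shows "l * (s / l) powr \<alpha> = l powr (1 - \<alpha>) * s powr \<alpha>"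
  using assms by (cases "l = 0") (auto simp: powr_divide powr_diff)

text \<open>The contribution of such a block to the linear form of the tangent when the mass it is
  applied to is again \<open>s\<close>. It turns the mean of the tangent into
  \<open>list_powr_sum\<close>.\<close>

lemma divide_powr_diff_one_mult:
  fixes l s \<alpha> :: real
  assumes "0 \<le> l" "0 \<le> s" "l = 0 \<Longrightarrow> s = 0"
  shows "(s / l) powr (\<alpha> - 1) * s = l powr (1 - \<alpha>) * s powr \<alpha>"
  using assms by (cases "s = 0") (auto simp: powr_divide powr_diff field_simps)

context
  fixes X S :: "'x set" and M L :: nat and e :: real
  assumes X: "finite X" "card X = M" and S: "S \<subseteq> X" "card S = L" and L: "1 \<le> L"
    and e: "e \<in> {0..1}" "L = M \<longrightarrow> e = 0"
begin

lemma sum_if_mem_list: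
  "(\<Sum>x\<in>X. if x \<in> S then f x else (g x :: real)) = (\<Sum>x\<in>S. f x) + (\<Sum>x\<in>X - S. g x)"
  using X S by (simp add: sum.If_cases Int_absorb1 Diff_eq)

lemma card_list_compl: "real (card (X - S)) = real M - real L"
  using card_mono[OF X(1) S(1)] X S by (simp add: card_Diff_subset finite_subset of_nat_diff)

lemma list_posterior_nonneg: "0 \<le> list_posterior M L e S x"
  using card_list_compl[symmetric] e by (simp add: list_posterior_def)

lemma sum_list_posterior: "(\<Sum>x\<in>X. list_posterior M L e S x) = 1"
  using e(2) L by (simp add: list_posterior_def sum_if_mem_list card_list_compl S(2))

lemma sum_list_posterior_powr:
  "(\<Sum>x\<in>X. list_posterior M L e S x powr \<alpha>) = list_powr_sum M L \<alpha> e"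
proof -
  have 0: "0 \<le> real M - real L" using card_list_compl[symmetric] by simp
  have "(\<Sum>x\<in>X. list_posterior M L e S x powr \<alpha>)
      = real L * ((1 - e) / real L) powr \<alpha> + (real M - real L) * (e / (real M - real L)) powr \<alpha>"
    by (simp add: list_posterior_def sum_if_mem_list card_list_compl S(2) if_distrib[of "\<lambda>t. t powr \<alpha>"])
  then show ?thesis using e(1) 0 by (simp add: mult_divide_powr list_powr_sum_def)
qed

text \<open>The extremal posterior is constant on the list and off it, so a linear form built from
  its powers sees \<open>v\<close> only through the mass that \<open>v\<close> puts on the
  list.\<close>

lemma sum_list_posterior_powr_mult:
  assumes "(\<Sum>x\<in>X. v x) = 1"
  shows "(\<Sum>x\<in>X. list_posterior M L e S x powr \<alpha> * v x)
    = ((1 - e) / real L) powr \<alpha> * (\<Sum>x\<in>X. if x \<in> S then v x else 0)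
      + (e / (real M - real L)) powr \<alpha> * (1 - (\<Sum>x\<in>X. if x \<in> S then v x else 0))"
proof -
  have "1 - (\<Sum>x\<in>S. v x) = (\<Sum>x\<in>X - S. v x)"
    using sum_if_mem_list[of v v] assms by simp
  then show ?thesis
    by (simp add: list_posterior_def sum_if_mem_list sum_distrib_left
        if_distrib[of "\<lambda>t. t powr \<alpha> * _"])
qed

text \<open>Supplies the support condition of \<open>powr_norm_tangent\<close>. The extremal
  posterior vanishes on the list only if \<open>e = 1\<close>, and off it only if
  \<open>e = 0\<close>; in either case \<open>v\<close> has no mass there.\<close>

lemma list_posterior_eq_0_imp:
  fixes v :: "'x \<Rightarrow> real"
  assumes v: "\<And>x. x \<in> X \<Longrightarrow> 0 \<le> v x" "(\<Sum>x\<in>X. v x) = 1"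
    and V: "e = 0 \<Longrightarrow> (\<Sum>x\<in>X. if x \<in> S then v x else 0) = 1"
      "e = 1 \<Longrightarrow> (\<Sum>x\<in>X. if x \<in> S then v x else 0) = 0"
    and x: "x \<in> X" "list_posterior M L e S x = 0"
  shows "v x = 0"
proof (cases "x \<in> S")
  case True
  with x L have "e = 1" by (simp add: list_posterior_def)
  with V(2)[unfolded sum_if_mem_list] have "(\<Sum>x\<in>S. v x) = 0" by simp
  then show ?thesis
    using True S v(1) X by (subst (asm) sum_nonneg_eq_0_iff) (auto intro: finite_subset)
next
  case False
  then have "S \<noteq> X" using x by auto
  then have "L \<noteq> M" using card_subset_eq[OF X(1) S(1)] X(2) S(2) by auto
  with False x have "e = 0" by (simp add: list_posterior_def)
  with V(1)[unfolded sum_if_mem_list] have "(\<Sum>x\<in>S. v x) = 1" by simp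
  with v(2) sum_if_mem_list[of v v] have "(\<Sum>x\<in>X - S. v x) = 0" by simp
  then show ?thesis
    using False x v(1) X by (subst (asm) sum_nonneg_eq_0_iff) auto
qed

end

section \<open>From power sums to logarithms and the divergence\<close>

lemma list_powr_sum_pos:
  assumes "1 \<le> L" "L \<le> M" "e \<in> {0..1}" "L = M \<longrightarrow> e = 0"
  shows "0 < list_powr_sum M L \<alpha> e"
proof (cases "e = 1")
  case True
  with assms have "L < M" by fastforce
  with True show ?thesis by (simp add: list_powr_sum_def)
next
  case False
  with assms have "0 < real L powr (1 - \<alpha>) * (1 - e) powr \<alpha>" by simp
  then show ?thesis unfolding list_powr_sum_def by (rule add_pos_nonneg) simp
qed

text \<open>The factor \<open>real M powr (\<alpha> - 1)\<close> comes out of both terms of the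
  divergence and its logarithm cancels \<open>log b M\<close>. The infinite branch does not arise:
  \<open>1 \<le> L\<close> excludes \<open>?q = 1\<close>, and \<open>?q = 0\<close> means
  \<open>L = M\<close>, hence \<open>e = 0\<close>.\<close>

lemma log_minus_binary_renyi_div:
  assumes b: "1 < b" and L: "1 \<le> L" "L \<le> M" and e: "e \<in> {0..1}" "L = M \<longrightarrow> e = 0"
    and \<alpha>: "0 < \<alpha>" "\<alpha> \<noteq> 1"
  shows "ereal (log b (real M)) - binary_renyi_div b \<alpha> e (1 - real L / real M)
    = ereal (1 / (1 - \<alpha>) * log b (list_powr_sum M L \<alpha> e))"
proof -
  let ?K = "list_powr_sum M L \<alpha> e" and ?q = "1 - real L / real M"
  have K: "0 < ?K" using list_powr_sum_pos[OF L e] .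
  have M: "0 < real M" using L by simp
  have q: "?q = (real M - real L) / real M" using M by (simp add: field_simps)
  have q1: "?q \<noteq> 1" using L M by simp
  have q0: "?q = 0 \<Longrightarrow> e = 0" using e(2) M by simp
  have *: "e powr \<alpha> * ?q powr (1 - \<alpha>) + (1 - e) powr \<alpha> * (1 - ?q) powr (1 - \<alpha>)
      = real M powr (\<alpha> - 1) * ?K"
  proof -
    have "?q powr (1 - \<alpha>) = real M powr (\<alpha> - 1) * (real M - real L) powr (1 - \<alpha>)"
      unfolding q using L M by (simp add: powr_divide powr_diff field_simps)
    moreover have "(1 - ?q) powr (1 - \<alpha>) = real M powr (\<alpha> - 1) * real L powr (1 - \<alpha>)"
      using L M by (simp add: powr_divide powr_diff field_simps)
    ultimately show ?thesis unfolding list_powr_sum_def by (simp only: algebra_simps)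
  qed
  have "binary_renyi_div b \<alpha> e ?q = ereal (1 / (\<alpha> - 1) * log b (real M powr (\<alpha> - 1) * ?K))"
    unfolding binary_renyi_div_def * using q1 q0 by auto
  also have "log b (real M powr (\<alpha> - 1) * ?K) = (\<alpha> - 1) * log b (real M) + log b ?K"
    using b M K by (simp add: log_mult log_powr)
  also have "1 / (\<alpha> - 1) * ((\<alpha> - 1) * log b (real M) + log b ?K)
      = log b (real M) - 1 / (1 - \<alpha>) * log b ?K"
    using \<alpha> by (simp add: field_simps)
  finally show ?thesis by simp
qed

text \<open>The prefactor \<open>\<alpha> / (1 - \<alpha>)\<close> changes sign together with
  \<open>1 - \<alpha>\<close>, so the two reversals for \<open>\<alpha> > 1\<close> cancel.\<close>

lemma mult_log_mono_signed:
  assumes b: "1 < (b::real)" and \<alpha>: "0 < \<alpha>" "\<alpha> \<noteq> 1" and I: "0 < I" "0 < J"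
    and le: "(1 - \<alpha>) * I \<le> (1 - \<alpha>) * J"
  shows "\<alpha> / (1 - \<alpha>) * log b I \<le> \<alpha> / (1 - \<alpha>) * log b J"
proof (cases "\<alpha> < 1")
  case True
  with le b I \<alpha> show ?thesis by (intro mult_left_mono) auto
next
  case False
  with \<alpha> have "1 < \<alpha>" by simp
  with le b I show ?thesis by (intro mult_left_mono_neg) (auto simp: divide_nonneg_neg less_imp_le)
qed

section \<open>The entropy bound and its equality case\<close>

theorem theorem8:
  fixes b \<alpha> :: real and M L :: nat
    and X :: "'x set" and N :: "'y measure" and P :: "('x \<times> 'y) measure"
    and \<L> :: "'y \<Rightarrow> 'x set"
  assumes "b > 1"
    and "finite X" and "card X = M"
    and "prob_space P" and "sets P = sets (count_space X \<Otimes>\<^sub>M N)"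
    and "1 \<le> L" and "L \<le> M"
    and "\<L> \<in> measurable N (count_space {S. S \<subseteq> X \<and> card S = L})"
    and "\<alpha> \<in> {0<..<1} \<union> {1<..}"
  shows "ereal (arimoto_renyi_entropy b \<alpha> X N P)
           \<le> ereal (log b (real M))
             - binary_renyi_div b \<alpha> (list_error_prob P \<L>) (1 - real L / real M) \<and>
         ereal (log b (real M))
             - binary_renyi_div b \<alpha> (list_error_prob P \<L>) (1 - real L / real M)
           = ereal (1 / (1 - \<alpha>) *
               log b (real L powr (1 - \<alpha>) * (1 - list_error_prob P \<L>) powr \<alpha>
                 + (real M - real L) powr (1 - \<alpha>) * list_error_prob P \<L> powr \<alpha>)) \<and>
         (ereal (arimoto_renyi_entropy b \<alpha> X N P)
             = ereal (log b (real M))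
               - binary_renyi_div b \<alpha> (list_error_prob P \<L>) (1 - real L / real M) \<longleftrightarrow>
           (AE y in obs_law N P. \<forall>x\<in>X.
              cond_prob_given N P x y =
                (if x \<in> \<L> y then (1 - list_error_prob P \<L>) / real L
                 else list_error_prob P \<L> / (real M - real L))))"
proof -
  note b = assms(1) and X = assms(2,3) and P = assms(4,5) and L = assms(6,7) and \<L> = assms(8)
  have \<alpha>: "0 < \<alpha>" "\<alpha> \<noteq> 1" using assms(9) by auto
  let ?Q = "obs_law N P" and ?v = "\<lambda>y x. cond_prob_given N P x y"
  define e where "e = list_error_prob P \<L>"
  define K where "K = list_powr_sum M L \<alpha> e"
  define V where "V y = (\<Sum>x\<in>X. if x \<in> \<L> y then ?v y x else 0)" for y
  define F where "F y = (\<Sum>x\<in>X. ?v y x powr \<alpha>) powr (1 / \<alpha>)" for y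
  \<comment> \<open>The tangent at the extremal posterior for the list at \<open>y\<close>,
    evaluated at the actual posterior; it is affine in the list mass \<open>V y\<close>.\<close>
  define G where "G y = K powr (1 / \<alpha> - 1)
    * (((1 - e) / real L) powr (\<alpha> - 1) * V y + (e / (real M - real L)) powr (\<alpha> - 1) * (1 - V y))" for y
  have "X \<noteq> {}" using X L by auto
  then obtain x0 where x0: "x0 \<in> X" by blast
  interpret Y: prob_space ?Q by (rule prob_space_obs_law[OF P x0])
  note [measurable] = measurable_cond_prob_given
  note v0 = cond_prob_given_nonneg
  have e01: "e \<in> {0..1}" and Vi: "integrable ?Q V" and VI: "(\<integral>y. V y \<partial>?Q) = 1 - e"
    using integral_list_posterior[OF P X(1) \<L>] by (simp_all add: e_def V_def[abs_def])
  have \<L>y: "\<L> y \<subseteq> X" "card (\<L> y) = L" if "y \<in> space ?Q" for y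
    using measurable_space[OF \<L>] that by (auto simp: space_obs_law)
  have V01: "AE y in ?Q. 0 \<le> V y \<and> V y \<le> 1"
    using AE_sum_cond_prob_given[OF P X(1)]
  proof eventually_elim
    case (elim y)
    have "V y \<le> (\<Sum>x\<in>X. ?v y x)" unfolding V_def by (intro sum_mono) (auto simp: v0)
    moreover have "0 \<le> V y" unfolding V_def by (intro sum_nonneg) (auto simp: v0)
    ultimately show ?case using elim by simp
  qed
  \<comment> \<open>A list of full size is the whole alphabet, so its posterior mass is 1 almost
    surely and no error occurs.\<close>
  have eM: "L = M \<longrightarrow> e = 0"
  proof
    assume LM: "L = M"
    have "AE y in ?Q. V y = 1"
      using AE_sum_cond_prob_given[OF P X(1)] AE_space
    proof eventually_elim
      case (elim y)
      then have "\<L> y = X" using \<L>y X LM card_subset_eq by metis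
      with elim show ?case by (simp add: V_def)
    qed
    then have "(\<integral>y. V y \<partial>?Q) = (\<integral>y. 1 \<partial>?Q)"
      using Vi by (intro integral_cong_AE) auto
    with VI show "e = 0" by (simp add: Y.prob_space)
  qed
  \<comment> \<open>As \<open>V\<close> lies between 0 and 1, an extreme mean forces the extreme
    value almost everywhere. This handles the values of \<open>e\<close> at which the extremal
    posterior has zeros.\<close>
  have V0: "AE y in ?Q. V y = 0" if "e = 1"
    using integral_nonneg_eq_0_iff_AE[OF Vi] V01 VI that by auto
  have V1: "AE y in ?Q. V y = 1" if "e = 0"
  proof -
    have "AE y in ?Q. 1 - V y = 0"
      using integral_nonneg_eq_0_iff_AE[of ?Q "\<lambda>y. 1 - V y"] Vi V01 VI that
      by (auto simp: Y.prob_space)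
    then show ?thesis by eventually_elim simp
  qed
  have K: "0 < K" unfolding K_def using L e01 eM by (rule list_powr_sum_pos)
  have pw: "AE y in ?Q. 0 < F y \<and> (1 - \<alpha>) * F y \<le> (1 - \<alpha>) * G y \<and>
      (F y = G y \<longleftrightarrow> (\<forall>x\<in>X. ?v y x = list_posterior M L e (\<L> y) x))"
  proof -
    have "AE y in ?Q. (e = 0 \<longrightarrow> V y = 1) \<and> (e = 1 \<longrightarrow> V y = 0)"
      using V0 V1 by (cases "e = 0"; cases "e = 1") auto
    then show ?thesis
      using AE_sum_cond_prob_given[OF P X(1)] AE_space
    proof eventually_elim
      case (elim y)
      note list = X \<L>y[OF elim(3)] L(1) e01 eM
      let ?w = "list_posterior M L e (\<L> y)"
      have w: "0 \<le> ?w x" "(\<Sum>x\<in>X. ?w x) = 1" for x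
        using list_posterior_nonneg[OF list] sum_list_posterior[OF list] by auto
      have "?v y x = 0" if "x \<in> X" "?w x = 0" for x
        by (rule list_posterior_eq_0_imp[OF list, of "?v y"]) (use elim that v0 in \<open>auto simp: V_def\<close>)
      then have ac: "\<forall>x\<in>X. ?w x = 0 \<longrightarrow> ?v y x = 0" by blast
      have G: "G y = (\<Sum>x\<in>X. ?w x powr \<alpha>) powr (1 / \<alpha> - 1) * (\<Sum>x\<in>X. ?w x powr (\<alpha> - 1) * ?v y x)"
        unfolding sum_list_posterior_powr[OF list] sum_list_posterior_powr_mult[OF list elim(2)]
        by (simp add: G_def K_def V_def)
      note tan = powr_norm_tangent[of X "?v y" ?w \<alpha>, OF X(1) v0 elim(2) w ac \<alpha>]
      have le: "(1 - \<alpha>) * F y \<le> (1 - \<alpha>) * G y"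
        unfolding G F_def by (rule tan(1))
      have eq: "F y = G y \<longleftrightarrow> (\<forall>x\<in>X. ?v y x = ?w x)"
        unfolding G F_def by (rule tan(2))
      have "(\<Sum>x\<in>X. ?v y x powr \<alpha>) \<noteq> 0"
      proof
        assume "(\<Sum>x\<in>X. ?v y x powr \<alpha>) = 0"
        then have "\<forall>x\<in>X. ?v y x = 0" using X(1) by (subst (asm) sum_nonneg_eq_0_iff) auto
        with elim(2) show False by simp
      qed
      then have "0 < F y" by (simp add: F_def)
      with le eq show ?case by simp
    qed
  qed
  \<comment> \<open>Posterior probabilities are at most 1, so \<open>F\<close> is bounded by
    \<open>real M powr (1 / \<alpha>)\<close> on a probability space.\<close>
  have Fi: "integrable ?Q F"
  proof (rule Y.integrable_const_bound)
    show "AE y in ?Q. norm (F y) \<le> real M powr (1 / \<alpha>)"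
      using AE_cond_prob_given_le_1[OF P X(1)]
    proof eventually_elim
      case (elim y)
      have "?v y x powr \<alpha> \<le> 1" if "x \<in> X" for x
        using elim that \<alpha> by (intro powr_le1) (auto simp: v0)
      then have "(\<Sum>x\<in>X. ?v y x powr \<alpha>) \<le> real M"
        using sum_mono[of X "\<lambda>x. ?v y x powr \<alpha>" "\<lambda>_. 1"] X by simp
      then show ?case unfolding F_def using \<alpha> by (auto intro!: powr_mono2 sum_nonneg)
    qed
    show "F \<in> borel_measurable ?Q" unfolding F_def[abs_def] by measurable
  qed
  have Gi: "integrable ?Q G" unfolding G_def[abs_def] using Vi by simp
  \<comment> \<open>Taking the mean replaces \<open>V y\<close> by \<open>1 - e\<close>, which is
    the list mass of the extremal posterior itself; there the tangent touches the norm.\<close>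
  have GI: "(\<integral>y. G y \<partial>?Q) = K powr (1 / \<alpha>)"
  proof -
    have "(\<integral>y. G y \<partial>?Q) = K powr (1 / \<alpha> - 1) * (((1 - e) / real L) powr (\<alpha> - 1) * (1 - e)
        + (e / (real M - real L)) powr (\<alpha> - 1) * e)"
      unfolding G_def using Vi VI by (simp add: Y.prob_space)
    also have "((1 - e) / real L) powr (\<alpha> - 1) * (1 - e)
        + (e / (real M - real L)) powr (\<alpha> - 1) * e = K"
      unfolding K_def list_powr_sum_def using L e01 eM by (simp add: divide_powr_diff_one_mult)
    finally show ?thesis using K by (simp add: powr_diff)
  qed
  define I where "I = (\<integral>y. F y \<partial>?Q)"
  have I: "0 < I"
  proof -
    have "AE y in ?Q. 0 \<le> F y" using pw by eventually_elim simp
    then have "0 \<le> I" unfolding I_def by (rule integral_nonneg_AE)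
    moreover have "I \<noteq> 0"
    proof
      assume "I = 0"
      then have "AE y in ?Q. F y = 0"
        using integral_nonneg_eq_0_iff_AE[OF Fi \<open>AE y in ?Q. 0 \<le> F y\<close>] by (simp add: I_def)
      with pw have "AE y in ?Q. False" by eventually_elim simp
      then show False by simp
    qed
    ultimately show ?thesis by simp
  qed
  \<comment> \<open>The signed gap between tangent and norm is nonnegative in both ranges of
    \<alpha>. Its mean gives the bound, and a zero mean amounts to a zero gap almost everywhere,
    which is the equality case.\<close>
  have Di: "integrable ?Q (\<lambda>y. (1 - \<alpha>) * G y - (1 - \<alpha>) * F y)" using Fi Gi by simp
  have DI: "(\<integral>y. (1 - \<alpha>) * G y - (1 - \<alpha>) * F y \<partial>?Q) = (1 - \<alpha>) * K powr (1 / \<alpha>) - (1 - \<alpha>) * I"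
    using Fi Gi GI by (simp add: I_def)
  have D0: "AE y in ?Q. 0 \<le> (1 - \<alpha>) * G y - (1 - \<alpha>) * F y" using pw by eventually_elim simp
  have le: "(1 - \<alpha>) * I \<le> (1 - \<alpha>) * K powr (1 / \<alpha>)"
    using integral_nonneg_AE[OF D0] DI by simp
  have eq: "I = K powr (1 / \<alpha>) \<longleftrightarrow> (AE y in ?Q. \<forall>x\<in>X. ?v y x = list_posterior M L e (\<L> y) x)"
  proof -
    have "I = K powr (1 / \<alpha>) \<longleftrightarrow> (AE y in ?Q. (1 - \<alpha>) * G y - (1 - \<alpha>) * F y = 0)"
      using integral_nonneg_eq_0_iff_AE[OF Di D0] DI \<alpha> by auto
    also have "\<dots> \<longleftrightarrow> (AE y in ?Q. \<forall>x\<in>X. ?v y x = list_posterior M L e (\<L> y) x)"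
    proof (rule eventually_subst)
      show "AE y in ?Q. ((1 - \<alpha>) * G y - (1 - \<alpha>) * F y = 0)
          = (\<forall>x\<in>X. ?v y x = list_posterior M L e (\<L> y) x)"
        using pw by eventually_elim (use \<alpha> in auto)
    qed
    finally show ?thesis .
  qed
  have H: "arimoto_renyi_entropy b \<alpha> X N P = \<alpha> / (1 - \<alpha>) * log b I"
    by (simp add: arimoto_renyi_entropy_def I_def F_def)
  \<comment> \<open>Written as a logarithm with the prefactor of the entropy, the bound can be
    compared with \<open>log b I\<close> by monotonicity and injectivity of the logarithm.\<close>
  have R: "1 / (1 - \<alpha>) * log b K = \<alpha> / (1 - \<alpha>) * log b (K powr (1 / \<alpha>))"
    using \<alpha> b K by (simp add: log_powr)
  have HR: "arimoto_renyi_entropy b \<alpha> X N P \<le> 1 / (1 - \<alpha>) * log b K"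
    unfolding H R using b \<alpha> I _ le by (rule mult_log_mono_signed) (use K in simp)
  have HReq: "arimoto_renyi_entropy b \<alpha> X N P = 1 / (1 - \<alpha>) * log b K \<longleftrightarrow> I = K powr (1 / \<alpha>)"
    unfolding H R using b I K \<alpha> by (simp add: inj_on_eq_iff[OF log_inj])
  show ?thesis
    unfolding e_def[symmetric] log_minus_binary_renyi_div[OF b L e01 eM \<alpha>] list_posterior_def[symmetric]
    using HR HReq eq by (simp add: K_def list_powr_sum_def)
qed

end
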